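(* The system of partial differential equations $E_1$ and $E_2$ consists of the following three groups of operators (i.e. the system $E_1+E_2$ is equivalent to, and generates the same left ideal of the Weyl algebra as, these operators): $$A\cdot\theta-{}^t\beta;$$ $$I_A=\{\partial^u-\partial^v : Au=Av,\ u,v\in\mathbb{N}_0^{16}\};$$ $$E_1(\ell,m)\ \text{ and }\ E_1'(\ell,m)\quad(\ell\ne m,\ \ell,m\in\{1,2\}).$$
   Context: Let $x^p_{jk}$ ($p\in\{1,2,3,4\}$, $j,k\in\{1,2\}$) be 16 variables ordered as $x^1_{11},x^1_{12},x^1_{21},x^1_{22},x^2_{11},\dots,x^4_{22}$, and $\partial^p_{jk}=\partial/\partial x^p_{jk}$. The system $E_1+E_2$ for a function $u(x)$ is: $E_1$: $\sum_{j,k}x^p_{jk}\partial^p_{jk}u=-\frac12u$ for $p=1,\dots,4$; $\sum_{p,j}x^p_{\ell j}\partial^p_{mj}u=-\delta_{\ell m}u$ and $\sum_{p,j}x^p_{j\ell}\partial^p_{jm}u=-\delta_{\ell m}u$ for $\ell,m\in\{1,2\}$. $E_2$: $\partial^q_{ij}\partial^p_{k\ell}u=\partial^q_{k\ell}\partial^p_{ij}u$ for $i,j,k,\ell\in\{1,2\}$ and $\partial^q_{11}\partial^p_{22}u=\partial^q_{21}\partial^p_{12}u$, for all $p,q\in\{1,2,3,4\}$. $E_1(\ell,m)=\sum_{p,j}x^p_{\ell j}\partial^p_{mj}+\delta_{\ell m}$ and $E_1'(\ell,m)=\sum_{p,j}x^p_{j\ell}\partial^p_{jm}+\delta_{\ell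 m}$. $\theta$ is the column vector of length 16 of the Euler operators $x^p_{jk}\partial^p_{jk}$; $\beta=(-\frac12,-\frac12,-\frac12,-\frac12,-1,-1)$; and $$A=\left(\begin{array}{cccccccccccccccc}1&1&1&1&0&0&0&0&0&0&0&0&0&0&0&0\\0&0&0&0&1&1&1&1&0&0&0&0&0&0&0&0\\0&0&0&0&0&0&0&0&1&1&1&1&0&0&0&0\\0&0&0&0&0&0&0&0&0&0&0&0&1&1&1&1\\1&1&0&0&1&1&0&0&1&1&0&0&1&1&0&0\\1&0&1&0&1&0&1&0&1&0&1&0&1&0&1&0\end{array}\right).$$ For $u\in\mathbb{N}_0^{16}$, $\partial^u$ is the corresponding monomial in the $\partial^p_{jk}$. *)

theory Defs
  imports
    "HOL-Analysis.Analysis"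
    "HOL-Library.Poly_Mapping"
    "HOL-Library.Function_Algebras"
    "HOL-Algebra.AbelCoset"
begin

(* The triple (p, j, k) indexes the variable x^p_jk.  In the numeral types 4 and 2 the numerals
   4 and 2 denote the same elements as 0, so 1, 2, 3, 4 and 1, 2 are complete lists without
   repetition. *)
type_synonym idx = "4 \<times> 2 \<times> 2"

definition idxs :: "idx list" where
  "idxs = [(p, j, k). p \<leftarrow> [1, 2, 3, 4], j \<leftarrow> [1, 2], k \<leftarrow> [1, 2]]"

lemma idxs_enumerates: "set idxs = UNIV" "distinct idxs" "length idxs = 16"
proof -
  show d: "distinct idxs" and l: "length idxs = 16" by (simp_all add: idxs_def)
  have "card (set idxs) = card (UNIV :: idx set)"
    using distinct_card[OF d] l by (simp add: card_cartesian_product flip: UNIV_Times_UNIV)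
  then show "set idxs = UNIV" by (intro card_subset_eq) auto
qed

definition A_mat :: "int list list" where
  "A_mat =
    [[1,1,1,1, 0,0,0,0, 0,0,0,0, 0,0,0,0],
     [0,0,0,0, 1,1,1,1, 0,0,0,0, 0,0,0,0],
     [0,0,0,0, 0,0,0,0, 1,1,1,1, 0,0,0,0],
     [0,0,0,0, 0,0,0,0, 0,0,0,0, 1,1,1,1],
     [1,1,0,0, 1,1,0,0, 1,1,0,0, 1,1,0,0],
     [1,0,1,0, 1,0,1,0, 1,0,1,0, 1,0,1,0]]"

definition beta :: "complex list" where
  "beta = [-1/2, -1/2, -1/2, -1/2, -1, -1]"

definition A_times :: "(idx \<Rightarrow>\<^sub>0 nat) \<Rightarrow> int list" where
  "A_times u = map (\<lambda>row. \<Sum>c<16. row ! c * int (Poly_Mapping.lookup u (idxs ! c))) A_mat"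

(* The operators are written down once, for an arbitrary complex vector space 'm on which the
   variables act by X and the partial derivatives by D.  They are used for polynomials, which
   gives elements of the Weyl algebra, and for functions, which gives differential equations. *)
locale diff_ops =
  fixes scal :: "complex \<Rightarrow> 'm :: ab_group_add \<Rightarrow> 'm"
    and X :: "idx \<Rightarrow> 'm \<Rightarrow> 'm"
    and D :: "idx \<Rightarrow> 'm \<Rightarrow> 'm"
begin

definition euler :: "idx \<Rightarrow> 'm \<Rightarrow> 'm" where
  "euler i = (\<lambda>u. X i (D i u))"

definition E1_p :: "4 \<Rightarrow> 'm \<Rightarrow> 'm" where
  "E1_p p = (\<lambda>u. (\<Sum>j\<in>UNIV. \<Sum>k\<in>UNIV. X (p, j, k) (D (p, j, k) u)) + scal (1/2) u)"

definition E1_row :: "2 \<Rightarrow> 2 \<Rightarrow> 'm \<Rightarrow> 'm" where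
  "E1_row l m = (\<lambda>u. (\<Sum>p\<in>UNIV. \<Sum>j\<in>UNIV. X (p, l, j) (D (p, m, j) u)) + (if l = m then u else 0))"

definition E1_col :: "2 \<Rightarrow> 2 \<Rightarrow> 'm \<Rightarrow> 'm" where
  "E1_col l m = (\<lambda>u. (\<Sum>p\<in>UNIV. \<Sum>j\<in>UNIV. X (p, j, l) (D (p, j, m) u)) + (if l = m then u else 0))"

definition E1 :: "('m \<Rightarrow> 'm) set" where
  "E1 = range E1_p \<union> {E1_row l m | l m. True} \<union> {E1_col l m | l m. True}"

definition E2 :: "('m \<Rightarrow> 'm) set" where
  "E2 = {(\<lambda>u. D (q, i, j) (D (p, k, l) u) - D (q, k, l) (D (p, i, j) u)) | p q i j k l. True}
      \<union> {(\<lambda>u. D (q, 1, 1) (D (p, 2, 2) u) - D (q, 2, 1) (D (p, 1, 2) u)) | p q. True}"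

definition A_theta_minus_beta :: "('m \<Rightarrow> 'm) set" where
  "A_theta_minus_beta =
     {(\<lambda>u. (\<Sum>c<16. scal (of_int (A_mat ! r ! c)) (euler (idxs ! c) u)) - scal (beta ! r) u) | r. r < 6}"

definition monom_D :: "(idx \<Rightarrow>\<^sub>0 nat) \<Rightarrow> 'm \<Rightarrow> 'm" where
  "monom_D a = foldr (\<lambda>i P. (D i ^^ Poly_Mapping.lookup a i) \<circ> P) idxs id"

definition I_A :: "('m \<Rightarrow> 'm) set" where
  "I_A = {(\<lambda>f. monom_D u f - monom_D v f) | u v. A_times u = A_times v}"

definition E1_offdiag :: "('m \<Rightarrow> 'm) set" where
  "E1_offdiag = {E1_row l m | l m. l \<noteq> m} \<union> {E1_col l m | l m. l \<noteq> m}"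

end

type_synonym cpoly = "(idx \<Rightarrow>\<^sub>0 nat) \<Rightarrow>\<^sub>0 complex"

definition pol_scal :: "complex \<Rightarrow> cpoly \<Rightarrow> cpoly" where
  "pol_scal c f = Poly_Mapping.single 0 c * f"

definition pol_X :: "idx \<Rightarrow> cpoly \<Rightarrow> cpoly" where
  "pol_X i f = Poly_Mapping.single (Poly_Mapping.single i 1) 1 * f"

definition pol_D :: "idx \<Rightarrow> cpoly \<Rightarrow> cpoly" where
  "pol_D i f = (\<Sum>a\<in>Poly_Mapping.keys f.
     Poly_Mapping.single (a - Poly_Mapping.single i 1)
       (of_nat (Poly_Mapping.lookup a i) * Poly_Mapping.lookup f a))"

(* The Weyl algebra in characteristic 0, as the algebra of endomorphisms of the polynomial ring
   generated by the variables and the partial derivatives. *)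
inductive_set weyl_carrier :: "(cpoly \<Rightarrow> cpoly) set" where
  scal: "pol_scal c \<in> weyl_carrier"
| X: "pol_X i \<in> weyl_carrier"
| D: "pol_D i \<in> weyl_carrier"
| add: "P \<in> weyl_carrier \<Longrightarrow> Q \<in> weyl_carrier \<Longrightarrow> (\<lambda>f. P f + Q f) \<in> weyl_carrier"
| comp: "P \<in> weyl_carrier \<Longrightarrow> Q \<in> weyl_carrier \<Longrightarrow> (\<lambda>f. P (Q f)) \<in> weyl_carrier"

definition weyl_algebra :: "(cpoly \<Rightarrow> cpoly) ring" where
  "weyl_algebra = \<lparr>carrier = weyl_carrier, mult = (\<lambda>P Q f. P (Q f)), one = (\<lambda>f. f),
     zero = (\<lambda>f. 0), add = (\<lambda>P Q f. P f + Q f)\<rparr>"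

lemma lookup_pol_D:
  "Poly_Mapping.lookup (pol_D i f) m =
   of_nat (Suc (Poly_Mapping.lookup m i)) * Poly_Mapping.lookup f (m + Poly_Mapping.single i 1)"
proof -
  let ?e = "Poly_Mapping.single i (1::nat)"
  have *: "Poly_Mapping.lookup (Poly_Mapping.single (a - ?e) (of_nat (Poly_Mapping.lookup a i) * Poly_Mapping.lookup f a)) m
     = (if a = m + ?e then of_nat (Suc (Poly_Mapping.lookup m i)) * Poly_Mapping.lookup f (m + ?e) else 0)" for a
  proof (cases "Poly_Mapping.lookup a i = 0")
    case True then show ?thesis by (auto simp: lookup_single lookup_add)
  next
    case False
    then have "a - ?e + ?e = a"
      by (intro poly_mapping_eqI) (auto simp: lookup_add lookup_minus lookup_single when_def)
    then have "a - ?e = m \<longleftrightarrow> a = m + ?e" by (metis add_diff_cancel_right')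
    then show ?thesis by (auto simp: lookup_single lookup_add when_def)
  qed
  show ?thesis unfolding pol_D_def lookup_sum *
    by (simp add: in_keys_iff)
qed

lemma pol_D_add: "pol_D i (f + g) = pol_D i f + pol_D i g"
  by (rule poly_mapping_eqI) (simp add: lookup_pol_D lookup_add algebra_simps)

lemma weyl_add: "P \<in> weyl_carrier \<Longrightarrow> P (f + g) = P f + P g"
  by (induction arbitrary: f g rule: weyl_carrier.induct)
     (simp_all add: pol_scal_def pol_X_def pol_D_add algebra_simps)

lemma weyl_id: "(\<lambda>f. f) \<in> weyl_carrier"
proof -
  have "pol_scal 1 = (\<lambda>f. f)" by (rule ext) (simp add: pol_scal_def)
  then show ?thesis using weyl_carrier.scal[of 1] by simp
qed

lemma weyl_zero: "(\<lambda>f. 0) \<in> weyl_carrier"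
proof -
  have "pol_scal 0 = (\<lambda>f. 0)" by (rule ext) (simp add: pol_scal_def)
  then show ?thesis using weyl_carrier.scal[of 0] by simp
qed

lemma weyl_if: "(\<lambda>f. if b then f else 0) \<in> weyl_carrier"
  by (cases b) (simp_all add: weyl_id weyl_zero)

lemma weyl_neg: "P \<in> weyl_carrier \<Longrightarrow> (\<lambda>f. - P f) \<in> weyl_carrier"
  using weyl_carrier.comp[OF weyl_carrier.scal[of "-1"], of P]
  by (simp add: pol_scal_def single_uminus single_one)

lemma ring_weyl_algebra: "ring weyl_algebra"
proof (rule ringI)
  show "abelian_group weyl_algebra"
    by (rule abelian_groupI)
       (auto simp: weyl_algebra_def fun_eq_iff algebra_simps weyl_zero intro: weyl_carrier.intros
         intro!: bexI[OF _ weyl_neg])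
  show "Group.monoid weyl_algebra"
    by (rule monoidI) (auto simp: weyl_algebra_def weyl_id intro: weyl_carrier.intros)
qed (auto simp: weyl_algebra_def weyl_add)

lemma pol_D_single: "pol_D i (Poly_Mapping.single a c) = Poly_Mapping.single (a - Poly_Mapping.single i 1) (of_nat (Poly_Mapping.lookup a i) * c)"
  by (auto simp: pol_D_def keys_single)

lemma pol_D_pol_X: "pol_D i (pol_X j f) = pol_X j (pol_D i f) + (if i = j then f else 0)"
proof -
  have D: "pol_D i (g + h) = pol_D i g + pol_D i h" for g h by (rule pol_D_add)
  have single: "pol_D i (pol_X j f) = pol_X j (pol_D i f) + (if i = j then f else 0)"
    if "f = Poly_Mapping.single a c" for f a c
  proof -
    let ?e = "\<lambda>i. Poly_Mapping.single i (1::nat)"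
    have 1: "Poly_Mapping.lookup a i \<noteq> 0 \<Longrightarrow> ?e j + (a - ?e i) = ?e j + a - ?e i"
      by (intro poly_mapping_eqI) (auto simp: lookup_add lookup_minus lookup_single when_def)
    show ?thesis unfolding that
      by (cases "Poly_Mapping.lookup a i = 0"; cases "i = j")
        (use 1 in \<open>auto simp: pol_X_def pol_D_single pol_D_single[unfolded One_nat_def] mult_single lookup_add lookup_single algebra_simps simp flip: single_add\<close>)
  qed
  have *: "f = (\<Sum>a\<in>Poly_Mapping.keys f. Poly_Mapping.single a (Poly_Mapping.lookup f a))"
    by (rule poly_mapping_eqI) (simp add: lookup_sum lookup_single when_def in_keys_iff)
  have "pol_D i (pol_X j (\<Sum>a\<in>K. Poly_Mapping.single a (g a))) = pol_X j (pol_D i (\<Sum>a\<in>K. Poly_Mapping.single a (g a))) + (if i = j then (\<Sum>a\<in>K. Poly_Mapping.single a (g a)) else 0)" for K g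
  proof (induction K rule: infinite_finite_induct)
    case (insert a K)
    then show ?case using single[OF refl, of a "g a"] by (simp add: pol_X_def D algebra_simps split: if_splits)
  qed (auto simp: pol_X_def pol_D_def)
  from this[of "Poly_Mapping.lookup f" "Poly_Mapping.keys f"] show ?thesis
    unfolding *[symmetric] .
qed

definition left_ideal :: "'a set \<Rightarrow> ('a, 'b) ring_scheme \<Rightarrow> bool" where
  "left_ideal I R \<longleftrightarrow> additive_subgroup I R \<and> (\<forall>r\<in>carrier R. \<forall>a\<in>I. r \<otimes>\<^bsub>R\<^esub> a \<in> I)"

definition gen_left_ideal :: "('a, 'b) ring_scheme \<Rightarrow> 'a set \<Rightarrow> 'a set" where
  "gen_left_ideal R S = \<Inter>{I. left_ideal I R \<and> S \<subseteq> I}"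

type_synonym cfun = "complex ^ idx \<Rightarrow> complex"

definition fun_scal :: "complex \<Rightarrow> cfun \<Rightarrow> cfun" where
  "fun_scal c u = (\<lambda>x. c * u x)"

definition fun_X :: "idx \<Rightarrow> cfun \<Rightarrow> cfun" where
  "fun_X i u = (\<lambda>x. x $ i * u x)"

definition fun_D :: "idx \<Rightarrow> cfun \<Rightarrow> cfun" where
  "fun_D i u = (\<lambda>x. deriv (\<lambda>t. u (x + axis i t)) 0)"

definition holomorphic_on_open :: "cfun \<Rightarrow> (complex ^ idx) set \<Rightarrow> bool" where
  "holomorphic_on_open u U \<longleftrightarrow> open U \<and>
     (\<forall>x\<in>U. \<exists>L. (u has_derivative L) (at x) \<and> (\<forall>c v. L (c *s v) = c * L v))"

definition solves_on :: "(complex ^ idx) set \<Rightarrow> cfun \<Rightarrow> (cfun \<Rightarrow> cfun) set \<Rightarrow> bool" where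
  "solves_on U u S \<longleftrightarrow> (\<forall>P\<in>S. \<forall>x\<in>U. P u x = 0)"

interpretation Weyl: diff_ops pol_scal pol_X pol_D .

interpretation Fun: diff_ops fun_scal fun_X fun_D .

lemma weyl_sum: "(\<And>i. i \<in> I \<Longrightarrow> P i \<in> weyl_carrier) \<Longrightarrow> (\<lambda>f. \<Sum>i\<in>I. P i f) \<in> weyl_carrier"
  by (induction I rule: infinite_finite_induct) (auto simp: weyl_zero intro: weyl_carrier.add)

lemma weyl_minus: "P \<in> weyl_carrier \<Longrightarrow> Q \<in> weyl_carrier \<Longrightarrow> (\<lambda>f. P f - Q f) \<in> weyl_carrier"
  using weyl_carrier.add[OF _ weyl_neg] by simp

lemma weyl_comp: "P \<in> weyl_carrier \<Longrightarrow> Q \<in> weyl_carrier \<Longrightarrow> P \<circ> Q \<in> weyl_carrier"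
  unfolding comp_def by (rule weyl_carrier.comp)

lemma weyl_pow: "P \<in> weyl_carrier \<Longrightarrow> P ^^ n \<in> weyl_carrier"
  by (induction n) (simp_all add: weyl_id weyl_comp id_def)

lemma weyl_monom: "Weyl.monom_D a \<in> weyl_carrier"
proof -
  have id: "id \<in> weyl_carrier" using weyl_id by (simp add: id_def)
  have "foldr (\<lambda>i P. (pol_D i ^^ Poly_Mapping.lookup a i) \<circ> P) xs id \<in> weyl_carrier" (is "?F xs \<in> _") for xs
  proof (induction xs)
    case Nil
    have "?F [] = id" by (rule ext) simp
    then show ?case by (simp only: id)
  next
    case (Cons i xs)
    have "?F (i # xs) = (pol_D i ^^ Poly_Mapping.lookup a i) \<circ> ?F xs" by (rule ext) simp
    then show ?case by (simp only: weyl_comp[OF weyl_pow[OF weyl_carrier.D] Cons.IH])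
  qed
  then show ?thesis unfolding Weyl.monom_D_def .
qed

lemma operators_in_weyl_algebra:
  "Weyl.E1 \<union> Weyl.E2 \<union> Weyl.A_theta_minus_beta \<union> Weyl.I_A \<union> Weyl.E1_offdiag \<subseteq> carrier weyl_algebra"
proof -
  note XD = weyl_carrier.comp[OF weyl_carrier.X weyl_carrier.D]
  have p: "Weyl.E1_p p \<in> weyl_carrier" for p
    unfolding Weyl.E1_p_def by (intro weyl_carrier.add weyl_sum XD weyl_carrier.scal)
  have row: "Weyl.E1_row l m \<in> weyl_carrier" for l m
    unfolding Weyl.E1_row_def by (intro weyl_carrier.add weyl_sum XD weyl_if)
  have col: "Weyl.E1_col l m \<in> weyl_carrier" for l m
    unfolding Weyl.E1_col_def by (intro weyl_carrier.add weyl_sum XD weyl_if)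
  have "Weyl.E2 \<subseteq> weyl_carrier"
    unfolding Weyl.E2_def
    using weyl_minus[OF weyl_carrier.comp[OF weyl_carrier.D weyl_carrier.D]
        weyl_carrier.comp[OF weyl_carrier.D weyl_carrier.D]] by blast
  moreover have "Weyl.A_theta_minus_beta \<subseteq> weyl_carrier"
  proof -
    have "(\<lambda>u. (\<Sum>c<16. pol_scal (of_int (A_mat ! r ! c)) (Weyl.euler (idxs ! c) u)) -
        pol_scal (beta ! r) u) \<in> weyl_carrier" for r
      unfolding Weyl.euler_def
      by (intro weyl_minus weyl_sum weyl_carrier.comp[OF weyl_carrier.scal XD] weyl_carrier.scal)
    then show ?thesis unfolding Weyl.A_theta_minus_beta_def by blast
  qed
  moreover have "Weyl.I_A \<subseteq> weyl_carrier"
    unfolding Weyl.I_A_def using weyl_minus[OF weyl_monom weyl_monom] by blast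
  ultimately show ?thesis
    using p row col by (auto simp: weyl_algebra_def Weyl.E1_def Weyl.E1_offdiag_def)
qed

end

theory Submission
  imports Defs "HOL-Complex_Analysis.Cauchy_Integral_Formula"
begin

text \<open>Both halves compare two systems of operators by their inclusion in a set \<open>G\<close> that is closed under sums,
negation and, on differences of monomials, left multiplication by partial derivatives: \<open>G\<close> is a left
ideal of the Weyl algebra, or the set of operators that annihilate a given holomorphic function.

The matrix \<open>A\<close> records the one-dimensional marginals of an exponent vector on the grid
\<open>4 \<times> 2 \<times> 2\<close>. If two vectors \<open>u\<close> and \<open>v\<close> have equal marginals and \<open>v\<close> contains the
cell \<open>(p, j, k)\<close>, then at most two exchanges of coordinates between cells of \<open>u\<close>, each a consequence
of \<open>E\<^sub>2\<close>, move \<open>(p, j, k)\<close> into \<open>u\<close>; cancelling it reduces the degree, so \<open>E\<^sub>2\<close> generates \<open>I\<^sub>A\<close>.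
The first-order parts agree up to the linear relation
\<open>E\<^sub>1(1,1) + E\<^sub>1(2,2) = E\<^sub>1'(1,1) + E\<^sub>1'(2,2) = \<Sum>\<^sub>p E\<^sub>1\<^sub>,\<^sub>p\<close>.
For functions one needs in addition that partial derivatives of holomorphic functions are holomorphic
and commute, which follows from Cauchy's formula in one variable.\<close>

section \<open>Exponent vectors with equal marginals\<close>

abbreviation expo :: "idx \<Rightarrow> idx \<Rightarrow>\<^sub>0 nat" where
  "expo i \<equiv> Poly_Mapping.single i (Suc 0)"

definition marg1 :: "(idx \<Rightarrow>\<^sub>0 nat) \<Rightarrow> 4 \<Rightarrow> nat" where
  "marg1 u p = (\<Sum>j\<in>UNIV. \<Sum>k\<in>UNIV. Poly_Mapping.lookup u (p, j, k))"
definition marg2 :: "(idx \<Rightarrow>\<^sub>0 nat) \<Rightarrow> 2 \<Rightarrow> nat" where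
  "marg2 u j = (\<Sum>p\<in>UNIV. \<Sum>k\<in>UNIV. Poly_Mapping.lookup u (p, j, k))"
definition marg3 :: "(idx \<Rightarrow>\<^sub>0 nat) \<Rightarrow> 2 \<Rightarrow> nat" where
  "marg3 u k = (\<Sum>p\<in>UNIV. \<Sum>j\<in>UNIV. Poly_Mapping.lookup u (p, j, k))"

lemmas marg_defs = marg1_def marg2_def marg3_def

lemma idxs_list: "idxs = [(1,1,1),(1,1,2),(1,2,1),(1,2,2),(2,1,1),(2,1,2),(2,2,1),(2,2,2),
    (3,1,1),(3,1,2),(3,2,1),(3,2,2),(4,1,1),(4,1,2),(4,2,1),(4,2,2)]"
  by (simp add: idxs_def)

lemma A_times_marg:
  "A_times u = [int (marg1 u 1), int (marg1 u 2), int (marg1 u 3), int (marg1 u 4), int (marg2 u 1), int (marg3 u 1)]"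
  by (simp add: A_times_def A_mat_def idxs_list marg_defs sum_2 sum_4 eval_nat_numeral)

definition marg_eq :: "(idx \<Rightarrow>\<^sub>0 nat) \<Rightarrow> (idx \<Rightarrow>\<^sub>0 nat) \<Rightarrow> bool" where
  "marg_eq u v \<longleftrightarrow> marg1 u = marg1 v \<and> marg2 u = marg2 v \<and> marg3 u = marg3 v"

text \<open>The last two rows of \<open>A_mat\<close> count only cells with second or third
  coordinate 1. The counts for coordinate 2 follow, because both pairs add up to the total degree,
  which the first four rows determine.\<close>

lemma A_times_eq_iff: "A_times u = A_times v \<longleftrightarrow> marg_eq u v"
proof
  assume *: "A_times u = A_times v"
  then have "marg1 u = marg1 v" by (auto simp: A_times_marg fun_eq_iff forall_4)
  moreover have "marg2 u 1 + marg2 u 2 = (\<Sum>p\<in>UNIV. marg1 u p)" "marg3 u 1 + marg3 u 2 = (\<Sum>p\<in>UNIV. marg1 u p)" for u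
    by (simp_all add: marg_defs sum_2 sum_4)
  moreover have "marg2 u 1 = marg2 v 1" "marg3 u 1 = marg3 v 1" using * by (simp_all add: A_times_marg)
  ultimately have "marg2 u 2 = marg2 v 2" "marg3 u 2 = marg3 v 2" by (metis add_left_cancel)+
  with \<open>marg1 u = marg1 v\<close> \<open>marg2 u 1 = marg2 v 1\<close> \<open>marg3 u 1 = marg3 v 1\<close> show "marg_eq u v"
    by (simp add: marg_eq_def fun_eq_iff forall_2)
qed (simp add: A_times_marg marg_eq_def)

lemma marg_add: "marg1 (u + v) p = marg1 u p + marg1 v p" "marg2 (u + v) j = marg2 u j + marg2 v j"
    "marg3 (u + v) k = marg3 u k + marg3 v k"
  by (simp_all add: marg_defs lookup_add sum.distrib)

lemma marg_expo: "marg1 (expo (q, i, l)) p = (if p = q then 1 else 0)"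
  "marg2 (expo (q, i, l)) j = (if j = i then 1 else 0)"
  "marg3 (expo (q, i, l)) k = (if k = l then 1 else 0)"
proof -
  \<comment> \<open>The product form lets the nested sums factor.\<close>
  have *: "Poly_Mapping.lookup (expo (q, i, l)) (p, j, k) = of_bool (p = q) * (of_bool (j = i) * of_bool (k = l))" for p j k
    by (auto simp: lookup_single)
  have one: "(\<Sum>x\<in>UNIV. of_bool (x = y)) = (1::nat)" for y :: "'x::finite"
    by (simp add: of_bool_def)
  show "marg1 (expo (q, i, l)) p = (if p = q then 1 else 0)"
    "marg2 (expo (q, i, l)) j = (if j = i then 1 else 0)"
    "marg3 (expo (q, i, l)) k = (if k = l then 1 else 0)"
    unfolding marg_defs * by (simp_all add: one flip: sum_distrib_left sum_distrib_right)
qed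

lemma marg_eq_refl [simp]: "marg_eq u u" and marg_eq_sym: "marg_eq u v \<Longrightarrow> marg_eq v u"
  and marg_eq_trans: "marg_eq u v \<Longrightarrow> marg_eq v w \<Longrightarrow> marg_eq u w"
  and marg_eq_add_left [simp]: "marg_eq (w + u) (w + v) \<longleftrightarrow> marg_eq u v"
  by (simp_all add: marg_eq_def marg_add fun_eq_iff)

lemma lookup_pos_decomp:
  assumes "Poly_Mapping.lookup u i > 0" obtains w where "u = expo i + w"
proof
  show "u = expo i + (u - expo i)"
    using assms by (intro poly_mapping_eqI) (auto simp: lookup_add lookup_minus lookup_single when_def)
qed

lemma marg_pos:
  "marg1 u p > 0 \<Longrightarrow> \<exists>j k. Poly_Mapping.lookup u (p, j, k) > 0"
  "marg2 u j > 0 \<Longrightarrow> \<exists>p k. Poly_Mapping.lookup u (p, j, k) > 0"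
  "marg3 u k > 0 \<Longrightarrow> \<exists>p j. Poly_Mapping.lookup u (p, j, k) > 0"
  by (rule ccontr, simp add: marg_defs)+

lemma decomp2:
  assumes "Poly_Mapping.lookup u a > 0" "Poly_Mapping.lookup u b > 0" "a \<noteq> b"
  obtains w where "u = w + (expo a + expo b)"
proof -
  obtain v where v: "u = expo a + v" using assms(1) by (rule lookup_pos_decomp)
  with assms have "Poly_Mapping.lookup v b > 0" by (simp add: lookup_add lookup_single)
  then obtain w where "v = expo b + w" by (rule lookup_pos_decomp)
  with v that[of w] show thesis by (simp add: algebra_simps)
qed

text \<open>\<open>R\<close> abstracts congruence of monomials. \<open>swap1\<close> exchanges the
  first coordinates of two cells; together with \<open>swap2\<close> it gives quadrics in the toric
  ideal of the Segre embedding of P^3 x P^1 x P^1.\<close>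

locale toric_congruence =
  fixes R :: "(idx \<Rightarrow>\<^sub>0 nat) \<Rightarrow> (idx \<Rightarrow>\<^sub>0 nat) \<Rightarrow> bool"
  assumes refl: "R u u" and sym: "R u v \<Longrightarrow> R v u" and trans: "R u v \<Longrightarrow> R v w \<Longrightarrow> R u w"
    and cong_expo: "R u v \<Longrightarrow> R (expo a + u) (expo a + v)"
    and swap1: "R (expo (q, i, j) + expo (p, k, l)) (expo (q, k, l) + expo (p, i, j))"
    and swap2: "R (expo (q, 1, 1) + expo (p, 2, 2)) (expo (q, 2, 1) + expo (p, 1, 2))"
begin

lemma cong:
  assumes "R u v"
  shows "R (w + u) (w + v)"
proof -
  have single: "R (Poly_Mapping.single a n + u) (Poly_Mapping.single a n + v)" if "R u v" for a n u v
  proof (induction n)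
    case (Suc n)
    have "Poly_Mapping.single a (Suc n) = expo a + Poly_Mapping.single a n"
      by (simp flip: single_add)
    then show ?case using cong_expo[OF Suc] by (simp add: add.assoc)
  qed (use that in simp)
  show ?thesis
  proof (induction w rule: update_induct)
    case (update w a n)
    have "Poly_Mapping.update a n w = Poly_Mapping.single a n + w"
      using update(1) by (intro poly_mapping_eqI)
        (auto simp: lookup_update lookup_add lookup_single in_keys_iff)
    then show ?case using single[OF update(3)] by (simp add: add.assoc)
  qed (use assms in simp)
qed

text \<open>Only cells that differ in both \<open>j\<close> and \<open>k\<close> need an argument:
  \<open>swap2\<close> passes between the diagonal and the antidiagonal of the 2 x 2 grid, and
  \<open>swap1\<close> then puts the right first coordinates on the two cells.\<close>

lemma swap3: "R (expo (q, j, k) + expo (p, j', k')) (expo (q, j, k') + expo (p, j', k))"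
proof (cases "j = j' \<or> k = k'")
  case True
  then show ?thesis using swap1[of q j k p j' k'] by (auto intro: refl)
next
  case False
  have s: "R (expo (q, 2, 1) + expo (p, 1, 2)) (expo (q, 2, 2) + expo (p, 1, 1))" for q p
    using sym[OF swap2[of q p]] swap1[of q 1 1 p 2 2] trans by blast
  have s': "R (expo (q, 1, 1) + expo (p, 2, 2)) (expo (q, 1, 2) + expo (p, 2, 1))" for q p
    using swap2[of q p] swap1[of q 2 1 p 1 2] trans by blast
  show ?thesis
    using False exhaust_2[of j] exhaust_2[of k] exhaust_2[of j'] exhaust_2[of k'] s s'[THEN sym] s[THEN sym] s'
    by auto
qed

text \<open>Each positive marginal provides a cell that agrees with the target in one coordinate.
  \<open>swap1\<close> brings the first two coordinates together in one cell, and
  \<open>swap3\<close> then supplies the third.\<close>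

lemma reach:
  assumes "marg1 u p > 0" "marg2 u j > 0" "marg3 u k > 0"
  obtains w where "R u (expo (p, j, k) + w)" "marg_eq u (expo (p, j, k) + w)"
proof -
  obtain j1 k1 where 1: "Poly_Mapping.lookup u (p, j1, k1) > 0" using marg_pos(1)[OF assms(1)] by blast
  obtain p2 k2 where 2: "Poly_Mapping.lookup u (p2, j, k2) > 0" using marg_pos(2)[OF assms(2)] by blast
  obtain v where v: "R u v" "Poly_Mapping.lookup v (p, j, k2) > 0" "marg_eq u v"
  proof (cases "(p, j1, k1) = (p2, j, k2)")
    case True
    then show thesis using that[of u] 1 refl by simp
  next
    case False
    with 1 2 obtain w where "u = w + (expo (p, j1, k1) + expo (p2, j, k2))" by (rule decomp2)
    then show thesis
      using that[of "w + (expo (p, j, k2) + expo (p2, j1, k1))"] cong[OF swap1]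
      by (simp add: lookup_add lookup_single marg_eq_def marg_add marg_expo fun_eq_iff)
  qed
  \<comment> \<open>The third cell is sought in \<open>v\<close>, since the first exchange may have
    moved the one in \<open>u\<close>; the marginal survives the exchange.\<close>
  have "marg3 v k > 0" using assms(3) v(3) by (simp add: marg_eq_def)
  then obtain p3 j3 where 3: "Poly_Mapping.lookup v (p3, j3, k) > 0" using marg_pos(3) by blast
  show thesis
  proof (cases "(p, j, k2) = (p3, j3, k)")
    case True
    with v(2) obtain w where "v = expo (p, j, k) + w" using lookup_pos_decomp[of v "(p, j, k)"] by auto
    then show thesis using v that by simp
  next
    case False
    with v(2) 3 obtain w where "v = w + (expo (p, j, k2) + expo (p3, j3, k))" by (rule decomp2)
    then have "R u (w + (expo (p, j, k) + expo (p3, j3, k2)))"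
      and "marg_eq u (w + (expo (p, j, k) + expo (p3, j3, k2)))"
      using trans[OF v(1)] cong[OF swap3] v(3) by (simp_all add: marg_eq_def marg_add marg_expo fun_eq_iff)
    then show thesis using that[of "w + expo (p3, j3, k2)"] by (simp add: add.left_commute)
  qed
qed

text \<open>Induction on the degree of \<open>v\<close>, measured as the sum of its first marginals.
  Cancelling the cell supplied by \<open>reach\<close> keeps the marginals equal.\<close>

lemma R_if_marg_eq:
  assumes "marg_eq u v"
  shows "R u v"
  using assms
proof (induction "\<Sum>p\<in>UNIV. marg1 v p" arbitrary: u v rule: less_induct)
  case less
  show ?case
  proof (cases "v = 0")
    case True
    have "Poly_Mapping.lookup u (p, j, k) = 0" for p j k
    proof -
      have "marg1 u p = 0" using less.prems True by (simp add: marg_eq_def marg1_def)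
      then show ?thesis by (simp add: marg1_def)
    qed
    then have "u = 0" by (intro poly_mapping_eqI) auto
    then show ?thesis using True refl by simp
  next
    case False
    then obtain p j k where "Poly_Mapping.lookup v (p, j, k) > 0"
      by (metis bot_nat_0.not_eq_extremum lookup_zero poly_mapping_eqI prod_cases3)
    then obtain v' where v: "v = expo (p, j, k) + v'" by (rule lookup_pos_decomp)
    have "marg1 u p > 0" "marg2 u j > 0" "marg3 u k > 0"
      using less.prems by (simp_all add: marg_eq_def v marg_add marg_expo)
    then obtain w where w: "R u (expo (p, j, k) + w)" "marg_eq u (expo (p, j, k) + w)"
      by (rule reach)
    have "marg_eq (expo (p, j, k) + w) (expo (p, j, k) + v')"
      using marg_eq_trans[OF marg_eq_sym[OF w(2)] less.prems] unfolding v .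
    moreover have "(\<Sum>p\<in>UNIV. marg1 v' p) < (\<Sum>p\<in>UNIV. marg1 v p)"
      by (simp add: v marg_add marg_expo sum.distrib)
    ultimately have "R w v'" using less.hyps by simp
    then show ?thesis using trans[OF w(1) cong_expo] v by simp
  qed
qed

end

section \<open>The two systems of operators\<close>

text \<open>The instances of \<open>G\<close> are the left ideals of the Weyl algebra and, for a function \<open>u\<close> on an
open set \<open>U\<close>, the set of operators \<open>P\<close> with \<open>P u = 0\<close> on \<open>U\<close>. In the second case \<open>D\<close> need not
commute with itself outside \<open>U\<close>, so that \<open>monom_expo\<close> is not an identity.\<close>
locale annihilator = diff_ops scal X D + vector_space scal
  for scal :: "complex \<Rightarrow> 'm :: ab_group_add \<Rightarrow> 'm" and X D :: "idx \<Rightarrow> 'm \<Rightarrow> 'm" +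
  fixes G :: "('m \<Rightarrow> 'm) set"
  assumes zero: "(\<lambda>f. 0) \<in> G"
    and add: "P \<in> G \<Longrightarrow> Q \<in> G \<Longrightarrow> (\<lambda>f. P f + Q f) \<in> G"
    and neg: "P \<in> G \<Longrightarrow> (\<lambda>f. - P f) \<in> G"
    and monom_expo: "(\<lambda>f. monom_D (expo i + a) f - D i (monom_D a f)) \<in> G"
    and D_cong: "(\<lambda>f. monom_D a f - monom_D b f) \<in> G \<Longrightarrow> (\<lambda>f. D i (monom_D a f) - D i (monom_D b f)) \<in> G"
begin

lemma diff: "P \<in> G \<Longrightarrow> Q \<in> G \<Longrightarrow> (\<lambda>f. P f - Q f) \<in> G"
  using add[OF _ neg] by simp

definition congr :: "('m \<Rightarrow> 'm) \<Rightarrow> ('m \<Rightarrow> 'm) \<Rightarrow> bool" (infix "\<sim>\<^sub>G" 50) where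
  "P \<sim>\<^sub>G Q \<longleftrightarrow> (\<lambda>f. P f - Q f) \<in> G"

lemma congr_refl: "P \<sim>\<^sub>G P"
  using zero by (simp add: congr_def)

lemma congr_sym: "P \<sim>\<^sub>G Q \<Longrightarrow> Q \<sim>\<^sub>G P"
  using neg[of "\<lambda>f. P f - Q f"] by (simp add: congr_def)

lemma congr_trans: "P \<sim>\<^sub>G Q \<Longrightarrow> Q \<sim>\<^sub>G S \<Longrightarrow> P \<sim>\<^sub>G S"
  using add[of "\<lambda>f. P f - Q f" "\<lambda>f. Q f - S f"] by (simp add: congr_def)

lemma monom_D_expo_single: "monom_D (expo i) = D i"
proof -
  have "foldr (\<lambda>j P. (D j ^^ Poly_Mapping.lookup (expo i) j) \<circ> P) xs id = (if i \<in> set xs then D i else id)"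
    if "distinct xs" for xs
    using that by (induction xs) (auto simp: lookup_single when_def)
  then show ?thesis using idxs_enumerates by (simp add: monom_D_def)
qed

lemma monom_D_expo2: "monom_D (expo i + expo j) \<sim>\<^sub>G (\<lambda>f. D i (D j f))"
  using monom_expo[of i "expo j"] by (simp add: congr_def monom_D_expo_single)

lemma I_A_subset_iff: "I_A \<subseteq> G \<longleftrightarrow> (\<forall>u v. marg_eq u v \<longrightarrow> monom_D u \<sim>\<^sub>G monom_D v)"
  unfolding I_A_def A_times_eq_iff congr_def by blast

text \<open>By \<open>monom_D_expo2\<close>, each product of two derivatives may be replaced by a
  monomial modulo \<open>G\<close>; this turns \<open>E2\<close> into the exchanges of
  \<open>toric_congruence\<close>.\<close>

lemma E2_subset_iff: "E2 \<subseteq> G \<longleftrightarrow>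
    (\<forall>p q i j k l. monom_D (expo (q, i, j) + expo (p, k, l)) \<sim>\<^sub>G monom_D (expo (q, k, l) + expo (p, i, j))) \<and>
    (\<forall>p q. monom_D (expo (q, 1, 1) + expo (p, 2, 2)) \<sim>\<^sub>G monom_D (expo (q, 2, 1) + expo (p, 1, 2)))"
proof -
  have "(\<lambda>f. D a (D b f) - D c (D d f)) \<in> G \<longleftrightarrow> monom_D (expo a + expo b) \<sim>\<^sub>G monom_D (expo c + expo d)" for a b c d
    using monom_D_expo2[of a b] monom_D_expo2[of c d] congr_sym congr_trans unfolding congr_def[of "\<lambda>f. D a (D b f)", symmetric]
    by blast
  then show ?thesis unfolding E2_def by blast
qed

text \<open>If \<open>G\<close> contains \<open>E2\<close>, congruence modulo \<open>G\<close> is a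
  toric congruence and hence relates all vectors with equal marginals. Conversely, the generators of
  \<open>E2\<close> are, modulo \<open>G\<close>, binomials whose exponents have equal
  marginals.\<close>

lemma E2_subset_iff_I_A_subset: "E2 \<subseteq> G \<longleftrightarrow> I_A \<subseteq> G"
proof
  assume "E2 \<subseteq> G"
  then interpret toric_congruence "\<lambda>u v. monom_D u \<sim>\<^sub>G monom_D v"
  proof (unfold_locales, goal_cases)
    case (4 u v a)
    then have "(\<lambda>f. D a (monom_D u f)) \<sim>\<^sub>G (\<lambda>f. D a (monom_D v f))" using D_cong by (simp add: congr_def)
    moreover have "monom_D (expo a + w) \<sim>\<^sub>G (\<lambda>f. D a (monom_D w f))" for w
      using monom_expo by (simp add: congr_def)
    ultimately show ?case using congr_sym congr_trans by blast
  next
    case (2 u v)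
    from 2(2) show ?case by (rule congr_sym)
  next
    case (3 u v w)
    from 3(2,3) show ?case by (rule congr_trans)
  qed (simp_all add: E2_subset_iff congr_refl)
  show "I_A \<subseteq> G" using R_if_marg_eq by (simp add: I_A_subset_iff)
next
  assume "I_A \<subseteq> G"
  moreover have "marg_eq (expo (q, i, j) + expo (p, k, l)) (expo (q, k, l) + expo (p, i, j))"
    "marg_eq (expo (q, 1, 1) + expo (p, 2, 2)) (expo (q, 2, 1) + expo (p, 1, 2))" for p q i j k l
    by (simp_all add: marg_eq_def marg_add marg_expo fun_eq_iff)
  ultimately show "E2 \<subseteq> G"
    unfolding I_A_subset_iff E2_subset_iff by blast
qed

text \<open>Four rows of \<open>A_mat\<close> sum over a fixed \<open>p\<close>, and the last two
  over \<open>j = 1\<close> and \<open>k = 1\<close>. The negated entries of \<open>beta\<close> are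
  the constants 1/2 and 1.\<close>

lemma A_theta_minus_beta_eq: "A_theta_minus_beta = range E1_p \<union> {E1_row 1 1, E1_col 1 1}"
proof -
  let ?op = "\<lambda>r u. (\<Sum>c<16. scal (of_int (A_mat ! r ! c)) (euler (idxs ! c) u)) - scal (beta ! r) u"
  have p: "?op 0 = E1_p 1" "?op 1 = E1_p 2" "?op 2 = E1_p 3" "?op 3 = E1_p 4"
    and rc: "?op 4 = E1_row 1 1" "?op 5 = E1_col 1 1"
    by (simp_all add: fun_eq_iff E1_p_def E1_row_def E1_col_def euler_def idxs_list A_mat_def beta_def
        eval_nat_numeral sum_2 sum_4 algebra_simps)
  have "{..<6::nat} = {0, 1, 2, 3, 4, 5}" by (auto simp: eval_nat_numeral lessThan_Suc)
  moreover have "A_theta_minus_beta = ?op ` {..<6}" unfolding A_theta_minus_beta_def by blast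
  ultimately have "A_theta_minus_beta = {E1_p 1, E1_p 2, E1_p 3, E1_p 4, E1_row 1 1, E1_col 1 1}"
    by (simp only: image_insert image_empty p rc)
  also have "\<dots> = range E1_p \<union> {E1_row 1 1, E1_col 1 1}"
    unfolding UNIV_4 by auto
  finally show ?thesis .
qed

lemma sum_E1_p: "(\<Sum>p\<in>UNIV. E1_p p u) = (\<Sum>p\<in>UNIV. \<Sum>j\<in>UNIV. \<Sum>k\<in>UNIV. X (p, j, k) (D (p, j, k) u)) + (u + u)"
proof -
  have "scal (1/2) u + scal (1/2) u = u" by (simp flip: scale_left_distrib)
  then have "(\<Sum>p\<in>(UNIV :: 4 set). scal (1/2) u) = u + u" by (simp add: sum_4 add.assoc)
  then show ?thesis by (simp only: E1_p_def sum.distrib)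
qed

text \<open>\<open>E1_row 2 2\<close>, like \<open>E1_col 2 2\<close>, is not listed in the second
  system. It is recovered because the four constants 1/2 and the two diagonal constants 1 both add
  up to 2.\<close>

lemma E1_row_22: "E1_row 2 2 = (\<lambda>u. (\<Sum>p\<in>UNIV. E1_p p u) - E1_row 1 1 u)"
proof
  fix u
  have "E1_row 1 1 u + E1_row 2 2 u = (\<Sum>p\<in>UNIV. E1_p p u)"
    by (simp add: sum_E1_p E1_row_def sum_2 sum.distrib ac_simps)
  then show "E1_row 2 2 u = (\<Sum>p\<in>UNIV. E1_p p u) - E1_row 1 1 u"
    by (simp add: eq_diff_eq add.commute)
qed

lemma E1_col_22: "E1_col 2 2 = (\<lambda>u. (\<Sum>p\<in>UNIV. E1_p p u) - E1_col 1 1 u)"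
proof
  fix u
  have "E1_col 1 1 u + E1_col 2 2 u = (\<Sum>p\<in>UNIV. E1_p p u)"
    by (simp add: sum_E1_p E1_col_def sum_2 sum.distrib ac_simps)
  then show "E1_col 2 2 u = (\<Sum>p\<in>UNIV. E1_p p u) - E1_col 1 1 u"
    by (simp add: eq_diff_eq add.commute)
qed

lemma E1_subset_iff: "E1 \<subseteq> G \<longleftrightarrow> A_theta_minus_beta \<union> E1_offdiag \<subseteq> G"
proof -
  have rc: "E1_row 2 2 \<in> G" "E1_col 2 2 \<in> G" if "A_theta_minus_beta \<subseteq> G"
    using that unfolding A_theta_minus_beta_eq E1_row_22 E1_col_22 by (auto simp: sum_4 intro!: add diff)
  have "E1_row l m \<in> G \<and> E1_col l m \<in> G" if "A_theta_minus_beta \<union> E1_offdiag \<subseteq> G" for l m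
  proof (cases "l = m")
    case True
    then show ?thesis using that rc exhaust_2[of m] by (auto simp: A_theta_minus_beta_eq)
  next
    case False
    then have "E1_row l m \<in> E1_offdiag" "E1_col l m \<in> E1_offdiag" unfolding E1_offdiag_def by blast+
    with that show ?thesis by blast
  qed
  moreover have "E1_p p \<in> G" if "A_theta_minus_beta \<subseteq> G" for p
    using that by (auto simp: A_theta_minus_beta_eq)
  ultimately have "E1 \<subseteq> G" if "A_theta_minus_beta \<union> E1_offdiag \<subseteq> G"
    using that by (auto simp: E1_def)
  moreover have "E1_offdiag \<subseteq> E1" "range E1_p \<subseteq> E1" by (auto simp: E1_offdiag_def E1_def)
  moreover have "E1_row 1 1 \<in> E1" "E1_col 1 1 \<in> E1" unfolding E1_def by blast+
  ultimately show ?thesis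
    unfolding A_theta_minus_beta_eq by auto
qed

lemma E1_E2_subset_iff: "E1 \<union> E2 \<subseteq> G \<longleftrightarrow> A_theta_minus_beta \<union> I_A \<union> E1_offdiag \<subseteq> G"
  using E1_subset_iff E2_subset_iff_I_A_subset by blast

end

text \<open>\<open>R\<close> stands for equality in the Weyl algebra and for equality on \<open>U\<close> for functions.\<close>
lemma (in diff_ops) monom_D_expo_add:
  assumes "equivp R"
    and D_cong: "\<And>i f g. R f g \<Longrightarrow> R (D i f) (D i g)"
    and D_closed: "\<And>i f. f \<in> C \<Longrightarrow> D i f \<in> C"
    and commute: "\<And>i j f. f \<in> C \<Longrightarrow> R (D i (D j f)) (D j (D i f))"
    and f: "f \<in> C"
  shows "R (monom_D (expo i + a) f) (D i (monom_D a f))"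
proof -
  note refl = equivp_reflp[OF assms(1)] and trans = equivp_transp[OF assms(1)]
  have pow_closed: "(D j ^^ n) g \<in> C" if "g \<in> C" for j n g
    using that by (induction n) (auto intro: D_closed)
  have pow_cong: "R ((D j ^^ n) g) ((D j ^^ n) h)" if "R g h" for j n g h
    using that by (induction n) (auto intro: D_cong)
  have pow_commute: "R ((D j ^^ n) (D i g)) (D i ((D j ^^ n) g))" if "g \<in> C" for j n g
  proof (induction n)
    case (Suc n)
    have "R (D j ((D j ^^ n) (D i g))) (D j (D i ((D j ^^ n) g)))" by (rule D_cong) (rule Suc)
    moreover have "R (D j (D i ((D j ^^ n) g))) (D i (D j ((D j ^^ n) g)))"
      by (rule commute) (rule pow_closed[OF that])
    ultimately show ?case using trans by simp
  qed (simp add: refl)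
  define F where "F a xs = foldr (\<lambda>i P. (D i ^^ Poly_Mapping.lookup a i) \<circ> P) xs id" for a xs
  have F_Cons: "F a (j # xs) g = (D j ^^ Poly_Mapping.lookup a j) (F a xs g)" for a j xs g
    by (simp add: F_def)
  have F_closed: "F a xs f \<in> C" for a xs
    by (induction xs) (simp_all add: F_Cons pow_closed, simp add: F_def f)
  \<comment> \<open>Over a list without \<open>i\<close> the two products agree literally. The entry
    \<open>i\<close> adds one factor \<open>D i\<close>, which is then commuted outward past the
    earlier entries.\<close>
  have "if i \<in> set xs then R (F (expo i + a) xs f) (D i (F a xs f)) else F (expo i + a) xs f = F a xs f"
    if "distinct xs" for xs
    using that
  proof (induction xs)
    case (Cons j xs)
    show ?case
    proof (cases "j = i")
      case True
      with Cons show ?thesis by (simp add: F_Cons lookup_add refl)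
    next
      case False
      then have l: "Poly_Mapping.lookup (expo i + a) j = Poly_Mapping.lookup a j"
        by (simp add: lookup_add lookup_single)
      show ?thesis
      proof (cases "i \<in> set xs")
        case True
        then have "R (F (expo i + a) xs f) (D i (F a xs f))" using Cons by simp
        from trans[OF pow_cong[OF this] pow_commute[OF F_closed]]
        show ?thesis using True by (simp add: F_Cons l)
      qed (use Cons False in \<open>simp add: F_Cons l\<close>)
    qed
  qed (simp add: F_def)
  from this[of idxs] show ?thesis using idxs_enumerates by (simp add: F_def monom_D_def)
qed

section \<open>Partial derivatives of holomorphic functions\<close>

lemma norm_axis [simp]: "norm (axis i x :: 'a::real_normed_vector ^ 'n) = norm x"
proof -
  have "norm (axis i x) = L2_set (\<lambda>j. norm ((if j = i then x else 0))) UNIV"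
    by (simp add: norm_vec_def axis_def)
  also have "\<dots> = L2_set (\<lambda>j. if j = i then norm x else 0) UNIV"
    by (intro L2_set_cong) auto
  also have "\<dots> = norm x"
    by (simp add: L2_set_def if_distrib[of "\<lambda>t. t\<^sup>2"] cong: if_cong)
  finally show ?thesis .
qed

lemma bounded_linear_axis: "bounded_linear (axis i :: 'a::real_normed_vector \<Rightarrow> 'a ^ 'n)"
proof (rule bounded_linear_intro[where K = 1])
  show "norm (axis i x :: 'a ^ 'n) \<le> norm x * 1" for x :: 'a by simp
qed (simp_all add: vec_eq_iff axis_def)

lemmas continuous_on_axis [continuous_intros] = bounded_linear.continuous_on[OF bounded_linear_axis]

lemma axis_cmul: "axis i (c * t) = c *s (axis i t :: complex ^ 'n)"
  by (simp add: vec_eq_iff axis_def)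

lemma sum_axis_mult: "(\<Sum>j\<in>UNIV. axis i (1::complex) $ j * f j) = f (i :: 'n::finite)"
  by (simp add: axis_def if_distrib[of "\<lambda>t. t * _"] cong: if_cong)

text \<open>Complex linearity reduces the derivative to its values on \<open>axis i 1\<close>, and
  the chain rule along a coordinate line identifies these with \<open>fun_D\<close>.\<close>

lemma holomorphic_on_openD:
  assumes "holomorphic_on_open u U"
  shows "open U"
    and "x \<in> U \<Longrightarrow> (u has_derivative (\<lambda>v. \<Sum>i\<in>UNIV. v $ i * fun_D i u x)) (at x)"
    and "continuous_on U u"
    and "x + axis i t \<in> U \<Longrightarrow>
      ((\<lambda>t. u (x + axis i t)) has_field_derivative fun_D i u (x + axis i t)) (at t)"
proof -
  show op: "open U" using assms by (simp add: holomorphic_on_open_def)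
  have line: "((\<lambda>t. u (x + axis i t)) has_field_derivative L (axis i 1)) (at t)"
    if "(u has_derivative L) (at (x + axis i t))" "\<forall>c v. L (c *s v) = c * L v" for x i t L
  proof -
    have "((\<lambda>t. x + axis i t) has_derivative axis i) (at t)"
      by (auto intro!: derivative_eq_intros bounded_linear.has_derivative[OF bounded_linear_axis])
    from has_derivative_compose[OF this that(1)]
    have "((\<lambda>t. u (x + axis i t)) has_derivative (\<lambda>s. L (axis i s))) (at t)" .
    moreover have "(\<lambda>s. L (axis i s)) = (*) (L (axis i 1))"
    proof
      fix s :: complex
      have "L (axis i s) = L (s *s axis i 1)" by (simp only: axis_cmul[symmetric] mult_1_right)
      then show "L (axis i s) = L (axis i 1) * s" by (simp only: that(2) mult.commute)
    qed
    ultimately show ?thesis unfolding has_field_derivative_def by simp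
  qed
  have D: "fun_D i u x = L (axis i 1)"
    if "(u has_derivative L) (at x)" "\<forall>c v. L (c *s v) = c * L v" for x i L
  proof -
    have z: "axis i (0::complex) = 0" by (simp add: vec_eq_iff axis_def)
    show ?thesis
      using line[of L x i 0] that by (simp add: z fun_D_def DERIV_imp_deriv)
  qed
  show *: "(u has_derivative (\<lambda>v. \<Sum>i\<in>UNIV. v $ i * fun_D i u x)) (at x)" if x: "x \<in> U" for x
  proof -
    from x assms obtain L where L: "(u has_derivative L) (at x)" "\<forall>c v. L (c *s v) = c * L v"
      unfolding holomorphic_on_open_def by blast
    interpret L: bounded_linear L using L(1) by (rule has_derivative_bounded_linear)
    have "L v = (\<Sum>i\<in>UNIV. v $ i * fun_D i u x)" for v
    proof -
      have "L v = L (\<Sum>i\<in>UNIV. (v $ i) *s axis i 1)" by (simp only: basis_expansion)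
      also have "\<dots> = (\<Sum>i\<in>UNIV. v $ i * fun_D i u x)" by (simp only: L.sum L(2) D[OF L])
      finally show ?thesis .
    qed
    then have "L = (\<lambda>v. \<Sum>i\<in>UNIV. v $ i * fun_D i u x)" by (rule ext)
    with L(1) show ?thesis by simp
  qed
  show "continuous_on U u"
    using * by (meson continuous_at_imp_continuous_on has_derivative_continuous)
  show "((\<lambda>t. u (x + axis i t)) has_field_derivative fun_D i u (x + axis i t)) (at t)"
    if "x + axis i t \<in> U"
  proof -
    from that assms obtain L where L: "(u has_derivative L) (at (x + axis i t))" "\<forall>c v. L (c *s v) = c * L v"
      unfolding holomorphic_on_open_def by blast
    show ?thesis using line[OF L] D[OF L] by simp
  qed
qed

definition circ :: "real \<Rightarrow> real \<Rightarrow> complex" where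
  "circ r t = of_real r * exp (2 * of_real pi * \<i> * of_real t)"

lemma norm_circ: "r > 0 \<Longrightarrow> norm (circ r t) = r"
  by (simp add: circ_def norm_mult norm_exp_eq_Re)

lemma continuous_on_circ [continuous_intros]:
  "continuous_on S f \<Longrightarrow> continuous_on S (\<lambda>x. circ r (f x))"
  unfolding circ_def by (intro continuous_intros)

text \<open>The radius \<open>2 * r\<close> leaves room for a circle of the same radius
  \<open>r\<close> around every point of \<open>ball x0 r\<close>, so that the contour in Cauchy's
  formula does not vary with \<open>x\<close>.\<close>

lemma mem_cball_axis:
  assumes "cball x0 (2 * r) \<subseteq> U" "x \<in> ball x0 r" "norm z \<le> r"
  shows "x + axis i (z::complex) \<in> U"
proof -
  have "dist x0 (x + axis i z) \<le> dist x0 x + norm (axis i z)"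
    by (metis dist_norm dist_triangle add_diff_cancel_left' dist_commute)
  also have "\<dots> \<le> 2 * r" using assms by simp
  finally show ?thesis using assms by auto
qed

text \<open>In the parametrised formula, the velocity of the circle cancels 2 pi i and one of the
  two powers of \<open>circ r t\<close>.\<close>

lemma fun_D_Cauchy:
  assumes u: "holomorphic_on_open u U" and U: "cball x0 (2 * r) \<subseteq> U" and x: "x \<in> ball x0 r"
  shows "fun_D i u x = integral (cbox 0 1) (\<lambda>t. u (x + axis i (circ r t)) / circ r t)"
proof -
  have r: "r > 0" using x by (metis le_less_trans mem_ball zero_le_dist)
  let ?f = "\<lambda>z. u (x + axis i z)"
  have d: "(?f has_field_derivative fun_D i u (x + axis i z)) (at z)" if "z \<in> cball 0 r" for z
    using holomorphic_on_openD(4)[OF u] mem_cball_axis[OF U x] that by simp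
  have "(?f has_field_derivative (1 / (2 * of_real pi * \<i>) * contour_integral (circlepath 0 r) (\<lambda>z. ?f z / (z - 0)^2))) (at 0)"
  proof (rule Cauchy_derivative_integral_circlepath(2))
    show "continuous_on (cball 0 r) ?f"
      using d by (meson DERIV_isCont continuous_at_imp_continuous_on)
    show "?f holomorphic_on ball 0 r"
      using d by (intro holomorphic_onI) (meson ball_subset_cball field_differentiable_at_within field_differentiable_def subsetD)
  qed (use r in simp)
  then have "fun_D i u x = 1 / (2 * of_real pi * \<i>) * contour_integral (circlepath 0 r) (\<lambda>z. ?f z / z^2)"
    by (simp add: fun_D_def DERIV_imp_deriv)
  also have "contour_integral (circlepath 0 r) (\<lambda>z. ?f z / z^2) =
      integral {0..1} (\<lambda>t. (2 * of_real pi * \<i>) * (?f (circ r t) / circ r t))"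
    unfolding contour_integral_integral
  proof (rule integral_cong)
    fix t :: real
    have c: "circlepath 0 r t = circ r t"
      by (simp add: circlepath_def part_circlepath_def circ_def linepath_def algebra_simps)
    have "vector_derivative (circlepath 0 r) (at t) = (2 * of_real pi * \<i>) * circ r t"
      by (simp add: vector_derivative_circlepath circ_def algebra_simps)
    then show "?f (circlepath 0 r t) / (circlepath 0 r t)^2 * vector_derivative (circlepath 0 r) (at t)
        = (2 * of_real pi * \<i>) * (?f (circ r t) / circ r t)"
      unfolding c by (simp add: power2_eq_square)
  qed
  also have "1 / (2 * of_real pi * \<i>) * \<dots> = integral {0..1} (\<lambda>t. ?f (circ r t) / circ r t)"
    unfolding integral_mult_right by simp
  finally show ?thesis by simp
qed

lemma continuous_on_circle_slice:
  assumes "continuous_on U f" "cball x0 (2 * r) \<subseteq> U" "r > 0"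
  shows "continuous_on (ball x0 r \<times> cbox 0 1) (\<lambda>(x, t). (f (x + axis i (circ r t)) :: complex) / circ r t)"
proof -
  have "continuous_on (ball x0 r \<times> cbox 0 1) (\<lambda>(p::(complex^_) \<times> real). f (fst p + axis i (circ r (snd p))))"
    by (rule continuous_on_compose2[OF assms(1)])
       (use assms in \<open>auto intro!: continuous_intros mem_cball_axis[OF assms(2)] simp: norm_circ\<close>)
  moreover have "circ r t \<noteq> 0" for t using norm_circ[OF assms(3), of t] assms(3) by auto
  ultimately show ?thesis
    unfolding split_beta by (intro continuous_intros) auto
qed

lemma open_obtain_cball2:
  assumes "open U" "x \<in> U" obtains r where "r > 0" "cball x (2 * r) \<subseteq> U"
proof -
  obtain e where "e > 0" "cball x e \<subseteq> U" using assms open_contains_cball by blast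
  then show ?thesis using that[of "e / 2"] by simp
qed

text \<open>This precedes differentiability, because differentiating Cauchy's formula under the
  integral puts first derivatives into the integrand.\<close>

lemma continuous_on_fun_D:
  assumes u: "holomorphic_on_open u U"
  shows "continuous_on U (fun_D i u)"
proof (rule continuous_at_imp_continuous_on, rule ballI)
  fix x0 assume "x0 \<in> U"
  then obtain r where r: "r > 0" "cball x0 (2 * r) \<subseteq> U"
    using holomorphic_on_openD(1)[OF u] open_obtain_cball2 by blast
  have "continuous_on (ball x0 r) (\<lambda>x. integral (cbox 0 1) (\<lambda>t. u (x + axis i (circ r t)) / circ r t))"
    by (rule integral_continuous_on_param continuous_on_circle_slice holomorphic_on_openD(3)[OF u] r)+
  then have "continuous_on (ball x0 r) (fun_D i u)"
    by (rule continuous_on_eq) (simp add: fun_D_Cauchy[OF u r(2)])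
  then show "isCont (fun_D i u) x0" using r(1) by (simp add: continuous_on_eq_continuous_at)
qed

text \<open>By differentiation of Cauchy's formula under the integral sign. The value on \<open>axis j 1\<close> is
Cauchy's formula for \<open>fun_D i (fun_D j u)\<close>, whence the symmetry of the second derivatives.\<close>
lemma fun_D_has_derivative:
  assumes u: "holomorphic_on_open u U" and x0: "x0 \<in> U"
  shows "\<exists>L. (fun_D i u has_derivative L) (at x0) \<and> (\<forall>c v. L (c *s v) = c * L v) \<and>
    (\<forall>r j. r > 0 \<longrightarrow> cball x0 (2 * r) \<subseteq> U \<longrightarrow>
      L (axis j 1) = integral (cbox 0 1) (\<lambda>t. fun_D j u (x0 + axis i (circ r t)) / circ r t))"
proof -
  \<comment> \<open>\<open>F r x t\<close> is the derivative in \<open>x\<close> of the integrand.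
    It is a bounded linear map by type, as \<open>leibniz_rule\<close> requires.\<close>
  define F where "F r x t = (\<Sum>j\<in>UNIV. blinfun_mult_right (fun_D j u (x + axis i (circ r t)) / circ r t) o\<^sub>L Blinfun (\<lambda>v. v $ j))" for r x t
  have F: "F r x t v = (\<Sum>j\<in>UNIV. v $ j * (fun_D j u (x + axis i (circ r t)) / circ r t))" for r x t v
    by (simp add: F_def blinfun.sum_left bounded_linear_Blinfun_apply bounded_linear_vec_nth mult.commute)
  have main: "(fun_D i u has_derivative integral (cbox 0 1) (F r x0)) (at x0)
     \<and> (\<forall>v. integral (cbox 0 1) (F r x0) v = integral (cbox 0 1) (\<lambda>t. F r x0 t v))"
    if r: "r > 0" "cball x0 (2 * r) \<subseteq> U" for r
  proof
    have c: "continuous_on (ball x0 r \<times> cbox 0 1) (\<lambda>(x, t). F r x t)"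
      unfolding F_def split_beta
      by (intro continuous_on_sum continuous_on_const
          bounded_bilinear.continuous_on[OF bounded_bilinear_blinfun_compose]
          bounded_linear.continuous_on[OF bounded_linear_blinfun_mult_right]
          continuous_on_circle_slice[OF continuous_on_fun_D[OF u], unfolded split_beta] r)
    have cx: "continuous_on (cbox 0 1) (f x)" if "continuous_on (ball x0 r \<times> cbox 0 1) (\<lambda>(x, t). f x t)" "x \<in> ball x0 r"
      for f :: "_ \<Rightarrow> real \<Rightarrow> 'z::topological_space" and x
      using that(2) by (auto intro!: continuous_on_compose2[OF that(1), of _ "\<lambda>t. (x, t)", simplified] continuous_intros)
    have "((\<lambda>x. integral (cbox 0 1) (\<lambda>t. u (x + axis i (circ r t)) / circ r t)) has_derivative
       integral (cbox 0 1) (F r x0)) (at x0 within ball x0 r)"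
    proof (rule leibniz_rule)
      fix x t assume x: "x \<in> ball x0 r" and "t \<in> cbox 0 (1::real)"
      have "x + axis i (circ r t) \<in> U" using mem_cball_axis[OF r(2) x] r by (simp add: norm_circ)
      from holomorphic_on_openD(2)[OF u this]
      have "((\<lambda>x. u (x + axis i (circ r t))) has_derivative
          (\<lambda>v. \<Sum>j\<in>UNIV. v $ j * fun_D j u (x + axis i (circ r t)))) (at x within ball x0 r)"
      proof (rule has_derivative_compose[where f = "\<lambda>x. x + axis i (circ r t)" and f' = "\<lambda>v. v", rotated])
        show "((\<lambda>x. x + axis i (circ r t)) has_derivative (\<lambda>v. v)) (at x within ball x0 r)"
          using has_derivative_add[OF has_derivative_ident has_derivative_const] by simp
      qed
      from bounded_linear.has_derivative[OF bounded_linear_divide this]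
      show "((\<lambda>x. u (x + axis i (circ r t)) / circ r t) has_derivative F r x t) (at x within ball x0 r)"
        by (simp add: F[abs_def] sum_divide_distrib)
    next
      fix x assume "x \<in> ball x0 r"
      then show "(\<lambda>t. u (x + axis i (circ r t)) / circ r t) integrable_on cbox 0 1"
        by (intro integrable_continuous cx[OF continuous_on_circle_slice[OF holomorphic_on_openD(3)[OF u] r(2,1)]])
    qed (use c r in auto)
    then have "(fun_D i u has_derivative integral (cbox 0 1) (F r x0)) (at x0 within ball x0 r)"
      by (rule has_derivative_transform_within[where d = 1]) (use r in \<open>auto simp: fun_D_Cauchy[OF u r(2)]\<close>)
    then show "(fun_D i u has_derivative integral (cbox 0 1) (F r x0)) (at x0)"
      using r(1) by (simp add: at_within_open[of x0 "ball x0 r"])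
    show "\<forall>v. integral (cbox 0 1) (F r x0) v = integral (cbox 0 1) (\<lambda>t. F r x0 t v)"
      by (intro allI blinfun_apply_integral integrable_continuous cx[OF c]) (use r in auto)
  qed
  obtain r0 where r0: "r0 > 0" "cball x0 (2 * r0) \<subseteq> U"
    using holomorphic_on_openD(1)[OF u] x0 open_obtain_cball2 by blast
  let ?L = "blinfun_apply (integral (cbox 0 1) (F r0 x0))"
  show ?thesis
  proof (intro exI[of _ ?L] conjI allI impI)
    show "(fun_D i u has_derivative ?L) (at x0)" using main[OF r0] by blast
    show "?L (c *s v) = c * ?L v" for c v
    proof -
      have "F r0 x0 t (c *s v) = c * F r0 x0 t v" for t
        by (simp only: F vector_smult_component mult.assoc flip: sum_distrib_left)
      then show ?thesis using conjunct2[OF main[OF r0]] by (simp only: integral_mult_right)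
    qed
    fix r j assume r: "r > 0" "cball x0 (2 * r) \<subseteq> U"
    \<comment> \<open>The witness was built with radius \<open>r0\<close>; uniqueness of the
      derivative identifies it with the one for the given \<open>r\<close>.\<close>
    have "?L = integral (cbox 0 1) (F r x0)"
      using has_derivative_unique main[OF r0] main[OF r] by blast
    then show "?L (axis j 1) = integral (cbox 0 1) (\<lambda>t. fun_D j u (x0 + axis i (circ r t)) / circ r t)"
      using main[OF r] by (simp only: F sum_axis_mult)
  qed
qed

lemma holomorphic_on_open_fun_D:
  assumes "holomorphic_on_open u U"
  shows "holomorphic_on_open (fun_D i u) U"
  using fun_D_has_derivative[OF assms] holomorphic_on_openD(1)[OF assms]
  unfolding holomorphic_on_open_def by blast

lemma fun_D_commute:
  assumes u: "holomorphic_on_open u U" and x: "x \<in> U"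
  shows "fun_D i (fun_D j u) x = fun_D j (fun_D i u) x"
proof -
  obtain r where r: "r > 0" "cball x (2 * r) \<subseteq> U"
    using holomorphic_on_openD(1)[OF u] x open_obtain_cball2 by blast
  obtain L where L: "(fun_D j u has_derivative L) (at x)"
    "\<And>r i. r > 0 \<Longrightarrow> cball x (2 * r) \<subseteq> U \<Longrightarrow>
      L (axis i 1) = integral (cbox 0 1) (\<lambda>t. fun_D i u (x + axis j (circ r t)) / circ r t)"
    using fun_D_has_derivative[OF u x, of j] by blast
  have "L = (\<lambda>v. \<Sum>k\<in>UNIV. v $ k * fun_D k (fun_D j u) x)"
    using L(1) holomorphic_on_openD(2)[OF holomorphic_on_open_fun_D[OF u] x] by (rule has_derivative_unique)
  then have "fun_D i (fun_D j u) x = L (axis i 1)"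
    by (simp only: sum_axis_mult)
  \<comment> \<open>The integral for \<open>L (axis i 1)\<close> is also Cauchy's formula in
    direction \<open>j\<close> for \<open>fun_D i u\<close>.\<close>
  also have "\<dots> = fun_D j (fun_D i u) x"
    using L(2)[OF r] fun_D_Cauchy[OF holomorphic_on_open_fun_D[OF u] r(2)] r(1) by simp
  finally show ?thesis .
qed

text \<open>A derivative depends only on values near the point, and the open set \<open>U\<close>
  contains a piece of the coordinate line around \<open>x\<close>.\<close>

lemma fun_D_cong:
  assumes "open U" "\<And>x. x \<in> U \<Longrightarrow> f x = g x" "x \<in> U"
  shows "fun_D i f x = fun_D i g x"
  unfolding fun_D_def
proof (rule deriv_cong_ev)
  have "isCont (\<lambda>t. x + axis i t) (0::complex)"
    by (intro continuous_intros bounded_linear.isCont[OF bounded_linear_axis])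
  then have "((\<lambda>t. x + axis i t) \<longlongrightarrow> x + axis i 0) (nhds (0::complex))"
    by (simp add: continuous_at_imp_continuous_at_within isCont_def tendsto_nhds_iff)
  moreover have "axis i (0::complex) = 0" by (simp add: vec_eq_iff axis_def)
  ultimately have "\<forall>\<^sub>F t in nhds 0. x + axis i t \<in> U"
    using assms topological_tendstoD by fastforce
  then show "\<forall>\<^sub>F t in nhds 0. f (x + axis i t) = g (x + axis i t)"
    by eventually_elim (rule assms)
qed simp

section \<open>Left ideals and solutions\<close>

lemma vector_space_pol_scal: "vector_space pol_scal"
  by unfold_locales (simp_all add: pol_scal_def algebra_simps mult_single single_add flip: mult.assoc)

lemma vector_space_fun_scal: "vector_space fun_scal"
  by unfold_locales (simp_all add: fun_scal_def fun_eq_iff algebra_simps)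

lemma pol_D_commute: "pol_D i (pol_D j f) = pol_D j (pol_D i f)"
  by (rule poly_mapping_eqI)
     (auto simp: lookup_pol_D lookup_add lookup_single when_def ac_simps)

lemma pol_D_diff: "pol_D i (f - g) = pol_D i f - pol_D i g"
  by (metis pol_D_add add_diff_cancel_right' diff_add_cancel)

lemma Weyl_annihilator:
  assumes "left_ideal I weyl_algebra"
  shows "annihilator pol_scal pol_D I"
proof -
  interpret additive_subgroup I weyl_algebra
    using assms by (simp add: left_ideal_def)
  have mult: "(\<lambda>f. P (Q f)) \<in> I" if "P \<in> weyl_carrier" "Q \<in> I" for P Q
    using assms that by (simp add: left_ideal_def weyl_algebra_def)
  have zero: "(\<lambda>f. 0) \<in> I" using zero_closed by (simp add: weyl_algebra_def)
  interpret vector_space pol_scal by (rule vector_space_pol_scal)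
  show ?thesis
  proof
    show "(\<lambda>f. 0) \<in> I" by (rule zero)
    show "(\<lambda>f. P f + Q f) \<in> I" if "P \<in> I" "Q \<in> I" for P Q
      using a_closed[OF that] by (simp add: weyl_algebra_def)
    show "(\<lambda>f. - P f) \<in> I" if "P \<in> I" for P
      using mult[OF weyl_carrier.scal[of "-1"] that] by simp
    show "(\<lambda>f. Weyl.monom_D (expo i + a) f - pol_D i (Weyl.monom_D a f)) \<in> I" for i a
    proof -
      have "Weyl.monom_D (expo i + a) f = pol_D i (Weyl.monom_D a f)" for f
        by (rule Weyl.monom_D_expo_add[where C = UNIV]) (auto simp: identity_equivp intro: pol_D_commute)
      then show ?thesis using zero by simp
    qed
    show "(\<lambda>f. pol_D i (Weyl.monom_D a f) - pol_D i (Weyl.monom_D b f)) \<in> I"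
      if "(\<lambda>f. Weyl.monom_D a f - Weyl.monom_D b f) \<in> I" for i a b
      using mult[OF weyl_carrier.D that] by (simp add: pol_D_diff)
  qed
qed

text \<open>All derivatives of \<open>u\<close> stay holomorphic on \<open>U\<close>, where they
  commute. Closure under derivatives rests on equality on \<open>U\<close>, because
  \<open>fun_D\<close> need not be additive on arbitrary functions.\<close>

lemma Fun_annihilator:
  assumes u: "holomorphic_on_open u U"
  shows "annihilator fun_scal fun_D {P. \<forall>x\<in>U. P u x = 0}"
proof -
  interpret vector_space fun_scal by (rule vector_space_fun_scal)
  define R where "R f g \<longleftrightarrow> (\<forall>x\<in>U. f x = g x)" for f g :: cfun
  have "equivp R" by (rule equivpI) (auto simp: R_def reflp_def symp_def transp_def)
  have D_cong: "R (fun_D i f) (fun_D i g)" if "R f g" for i f g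
    using that fun_D_cong[OF holomorphic_on_openD(1)[OF u]] unfolding R_def by blast
  have monom: "R (Fun.monom_D (expo i + a) u) (fun_D i (Fun.monom_D a u))" for i a
    by (rule Fun.monom_D_expo_add[where C = "{f. holomorphic_on_open f U}"])
       (use \<open>equivp R\<close> D_cong u in \<open>auto intro: holomorphic_on_open_fun_D simp: fun_D_commute R_def[of "fun_D _ (fun_D _ _)"]\<close>)
  show ?thesis
  proof
    show "(\<lambda>f. Fun.monom_D (expo i + a) f - fun_D i (Fun.monom_D a f)) \<in> {P. \<forall>x\<in>U. P u x = 0}" for i a
      using monom[of i a] by (simp add: R_def)
    show "(\<lambda>f. fun_D i (Fun.monom_D a f) - fun_D i (Fun.monom_D b f)) \<in> {P. \<forall>x\<in>U. P u x = 0}"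
      if "(\<lambda>f. Fun.monom_D a f - Fun.monom_D b f) \<in> {P. \<forall>x\<in>U. P u x = 0}" for i a b
      using that D_cong[of "Fun.monom_D a u" "Fun.monom_D b u" i] by (simp add: R_def)
  qed simp_all
qed

theorem proposition4p2:
  shows "gen_left_ideal weyl_algebra (Weyl.E1 \<union> Weyl.E2) =
      gen_left_ideal weyl_algebra (Weyl.A_theta_minus_beta \<union> Weyl.I_A \<union> Weyl.E1_offdiag)
    \<and> (\<forall>U u. holomorphic_on_open u U \<longrightarrow>
      (solves_on U u (Fun.E1 \<union> Fun.E2) \<longleftrightarrow>
       solves_on U u (Fun.A_theta_minus_beta \<union> Fun.I_A \<union> Fun.E1_offdiag)))"
proof (intro conjI allI impI)
  \<comment> \<open>The same left ideals contain both systems, so the intersections that define the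
    generated ideals coincide.\<close>
  have "left_ideal I weyl_algebra \<and> Weyl.E1 \<union> Weyl.E2 \<subseteq> I \<longleftrightarrow>
      left_ideal I weyl_algebra \<and> Weyl.A_theta_minus_beta \<union> Weyl.I_A \<union> Weyl.E1_offdiag \<subseteq> I" for I
    using annihilator.E1_E2_subset_iff[OF Weyl_annihilator] by blast
  then show "gen_left_ideal weyl_algebra (Weyl.E1 \<union> Weyl.E2) =
      gen_left_ideal weyl_algebra (Weyl.A_theta_minus_beta \<union> Weyl.I_A \<union> Weyl.E1_offdiag)"
    by (simp only: gen_left_ideal_def)
next
  fix U u
  assume "holomorphic_on_open u U"
  moreover have "solves_on U u S \<longleftrightarrow> S \<subseteq> {P. \<forall>x\<in>U. P u x = 0}" for S
    by (auto simp: solves_on_def)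
  ultimately show "solves_on U u (Fun.E1 \<union> Fun.E2) \<longleftrightarrow>
       solves_on U u (Fun.A_theta_minus_beta \<union> Fun.I_A \<union> Fun.E1_offdiag)"
    using annihilator.E1_E2_subset_iff[OF Fun_annihilator] by simp
qed

end
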